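(* Let $\alpha$ and $\beta$ be real numbers with $\alpha<\beta$. If $u:\mathbb{B}^2\to(\alpha,\beta)$ is a real-valued harmonic function, then $$|\nabla u(z)|\le\frac{2(\beta-\alpha)}{\pi}\cdot\frac{1-\frac{4}{(\beta-\alpha)^2}\left|u(z)-\frac{\alpha+\beta}{2}\right|^2}{1-|z|^2},\qquad z\in\mathbb{B}^2.$$ The result is sharp: for all $\alpha<\beta$ there are a harmonic function $u:\mathbb{B}^2\to(\alpha,\beta)$ and a point $z\in\mathbb{B}^2$ for which equality holds.
   Context: $\mathbb{B}^2$ is the open unit disk in the plane, $\nabla u=(\partial u/\partial x_1,\partial u/\partial x_2)$ is the gradient and $|\cdot|$ the Euclidean norm. *)

theory Defs
  imports "HOL-Analysis.Analysis"
begin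

text \<open>For a function given on an open set \<open>S\<close>, the values of the total function outside \<open>S\<close> are
  irrelevant to the partial derivatives at points of \<open>S\<close>.\<close>

definition partial_deriv :: "'a::euclidean_space \<Rightarrow> ('a \<Rightarrow> real) \<Rightarrow> 'a \<Rightarrow> real" where
  "partial_deriv b u x = deriv (\<lambda>t. u (x + t *\<^sub>R b)) 0"

definition gradient :: "('a::euclidean_space \<Rightarrow> real) \<Rightarrow> 'a \<Rightarrow> 'a" where
  "gradient u x = (\<Sum>b\<in>Basis. partial_deriv b u x *\<^sub>R b)"

text \<open>Existence of the partial derivatives is required explicitly, since \<^const>\<open>deriv\<close> is
  total and has an unspecified value where no derivative exists.\<close>

definition C1_on :: "'a::euclidean_space set \<Rightarrow> ('a \<Rightarrow> real) \<Rightarrow> bool" where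
  "C1_on S u \<longleftrightarrow> (\<forall>b\<in>Basis.
     (\<forall>x\<in>S. (\<lambda>t::real. u (x + t *\<^sub>R b)) differentiable (at 0)) \<and>
     continuous_on S (partial_deriv b u))"

definition C2_on :: "'a::euclidean_space set \<Rightarrow> ('a \<Rightarrow> real) \<Rightarrow> bool" where
  "C2_on S u \<longleftrightarrow> C1_on S u \<and> (\<forall>b\<in>Basis. C1_on S (partial_deriv b u))"

definition laplacian :: "('a::euclidean_space \<Rightarrow> real) \<Rightarrow> 'a \<Rightarrow> real" where
  "laplacian u x = (\<Sum>b\<in>Basis. partial_deriv b (partial_deriv b u) x)"

definition harmonic_on :: "'a::euclidean_space set \<Rightarrow> ('a \<Rightarrow> real) \<Rightarrow> bool" where
  "harmonic_on S u \<longleftrightarrow> open S \<and> C2_on S u \<and> (\<forall>x\<in>S. laplacian u x = 0)"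

text \<open>The plane is the type \<^typ>\<open>complex\<close>, with coordinates \<^const>\<open>Re\<close> and \<^const>\<open>Im\<close>, orthonormal
  basis \<open>1, \<i>\<close>, and the Euclidean norm.\<close>

abbreviation unit_disk :: "complex set" where
  "unit_disk \<equiv> ball 0 1"

lemma gradient_complex:
  fixes u :: "complex \<Rightarrow> real"
  shows "gradient u z = Complex (partial_deriv 1 u z) (partial_deriv \<i> u z)"
  by (simp add: gradient_def Basis_complex_def complex_eq_iff)

lemma laplacian_complex:
  fixes u :: "complex \<Rightarrow> real"
  shows "laplacian u z =
    partial_deriv 1 (partial_deriv 1 u) z + partial_deriv \<i> (partial_deriv \<i> u) z"
  by (simp add: laplacian_def Basis_complex_def)

lemma GDERIV_imp_gradient:
  assumes "GDERIV u x :> D"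
  shows "gradient u x = D"
proof -
  have "partial_deriv b u x = b \<bullet> D" for b
  proof -
    have 1: "(u has_derivative (\<lambda>h. h \<bullet> D)) (at (x + 0 *\<^sub>R b))"
      using assms by (simp add: gderiv_def)
    have 2: "((\<lambda>t::real. x + t *\<^sub>R b) has_derivative (\<lambda>t. t *\<^sub>R b)) (at 0)"
      by (auto intro!: derivative_eq_intros)
    have "((\<lambda>t. u (x + t *\<^sub>R b)) has_derivative (\<lambda>t. (t *\<^sub>R b) \<bullet> D)) (at 0)"
      using has_derivative_compose[OF 2 1] .
    then have "((\<lambda>t. u (x + t *\<^sub>R b)) has_field_derivative (b \<bullet> D)) (at 0)"
      by (auto simp: has_field_derivative_def mult.commute elim!: has_derivative_eq_rhs)
    then show ?thesis
      unfolding partial_deriv_def by (rule DERIV_imp_deriv)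
  qed
  then show ?thesis
    by (simp add: gradient_def inner_commute[of _ D] euclidean_representation)
qed

end

theory Submission
  imports Defs "HOL-Complex_Analysis.Complex_Analysis"
begin

text \<open>
  After an affine change of the values, the theorem is the Schwarz--Pick lemma for the strip
  \<open>\<bar>Re w\<bar> < 1\<close>. On the disk, a convex set, \<open>u\<close> is the real part of a holomorphic function
  \<open>f\<close> (\<open>harmonic_eq_Re_holomorphic\<close>), and the Cauchy--Riemann equations make \<open>f'\<close> the complex
  conjugate of the gradient of \<open>u\<close>. Rescaling sends the strip \<open>\<alpha> < Re w < \<beta>\<close> to
  \<open>\<bar>Re w\<bar> < 1\<close>, which \<open>tan (\<pi> w / 4)\<close> maps into the unit disk; the Schwarz--Pick lemma for
  this composition says that the rescaled function \<open>F\<close> satisfies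
  \<open>\<bar>F' z\<bar> \<le> 4/\<pi> cos (\<pi>/2 Re (F z)) / (1 - \<bar>z\<bar>\<^sup>2)\<close> (\<open>Schwarz_Pick_strip\<close>).
  The stated bound is slightly weaker, because \<open>cos (\<pi> x / 2) \<le> 1 - x\<^sup>2\<close> on \<open>[-1, 1]\<close>
  (\<open>cos_half_pi_le\<close>). Both inequalities become equalities at the origin for a conformal map of
  the disk onto the strip that sends \<open>0\<close> to the middle of the strip: the first because the map is
  conformal and onto, the second because it is an equality at \<open>x = 0\<close>. Hence the bound is sharp.

  The definition of a harmonic function only speaks of partial derivatives along the coordinate
  axes. To reach holomorphic functions one needs two facts of real calculus: continuous partial
  derivatives give total differentiability (\<open>C1_on_imp_GDERIV\<close>), and the mixed second partial
  derivatives agree (\<open>mixed_partials_commute\<close>).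
\<close>

section \<open>Partial derivatives of continuously differentiable functions\<close>

lemma C1_on_partial_has_derivative:
  assumes "C1_on S u" "b \<in> Basis" "x + t *\<^sub>R b \<in> S"
  shows "((\<lambda>t. u (x + t *\<^sub>R b)) has_real_derivative partial_deriv b u (x + t *\<^sub>R b)) (at t)"
proof -
  have "(\<lambda>s::real. u (x + t *\<^sub>R b + s *\<^sub>R b)) differentiable (at 0)"
    using assms unfolding C1_on_def by blast
  then have "((\<lambda>s. u (x + t *\<^sub>R b + s *\<^sub>R b)) has_real_derivative partial_deriv b u (x + t *\<^sub>R b)) (at 0)"
    unfolding partial_deriv_def by (simp add: DERIV_deriv_iff_real_differentiable)
  then have "((\<lambda>s. u (x + (s + t) *\<^sub>R b)) has_real_derivative partial_deriv b u (x + t *\<^sub>R b)) (at 0)"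
    by (simp add: algebra_simps)
  then show ?thesis
    using DERIV_shift[of "\<lambda>s. u (x + s *\<^sub>R b)" _ 0 t] by simp
qed

text \<open>
  Two applications of the mean value theorem, along \<open>a\<close> and then along \<open>b\<close>. The second difference
  is symmetric in \<open>a\<close> and \<open>b\<close>, so that the two orders of differentiation can be compared.
\<close>

lemma second_difference_eq_mixed_partial:
  assumes u: "C2_on S u" and ab: "a \<in> Basis" "b \<in> Basis" and "0 < h"
    and box: "\<And>s t. \<lbrakk>0 \<le> s; s \<le> h; 0 \<le> t; t \<le> h\<rbrakk> \<Longrightarrow> x + s *\<^sub>R a + t *\<^sub>R b \<in> S"
  obtains s t where "0 < s" "s < h" "0 < t" "t < h"
    "u (x + h *\<^sub>R a + h *\<^sub>R b) - u (x + h *\<^sub>R a) - u (x + h *\<^sub>R b) + u x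
      = h\<^sup>2 * partial_deriv b (partial_deriv a u) (x + s *\<^sub>R a + t *\<^sub>R b)"
proof -
  have C1: "C1_on S u" "C1_on S (partial_deriv a u)"
    using u ab unfolding C2_on_def by auto
  have da: "((\<lambda>s. u (x + t *\<^sub>R b + s *\<^sub>R a)) has_real_derivative
              partial_deriv a u (x + t *\<^sub>R b + s *\<^sub>R a)) (at s)"
    if "0 \<le> s" "s \<le> h" "0 \<le> t" "t \<le> h" for s t
    using box[OF that] by (intro C1_on_partial_has_derivative[OF C1(1) ab(1)]) (simp add: algebra_simps)
  obtain s where s: "0 < s" "s < h"
    "(u (x + h *\<^sub>R b + h *\<^sub>R a) - u (x + h *\<^sub>R a)) - (u (x + h *\<^sub>R b) - u x)
      = h * (partial_deriv a u (x + h *\<^sub>R b + s *\<^sub>R a) - partial_deriv a u (x + s *\<^sub>R a))"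
  proof -
    have "\<exists>z>0. z < h \<and>
      (\<lambda>s. u (x + h *\<^sub>R b + s *\<^sub>R a) - u (x + s *\<^sub>R a)) h
        - (\<lambda>s. u (x + h *\<^sub>R b + s *\<^sub>R a) - u (x + s *\<^sub>R a)) 0
      = (h - 0) * (partial_deriv a u (x + h *\<^sub>R b + z *\<^sub>R a) - partial_deriv a u (x + z *\<^sub>R a))"
      using da[of _ h] da[of _ 0] \<open>0 < h\<close> by (intro MVT2 DERIV_diff) auto
    then show thesis using that by auto
  qed
  have "\<exists>t>0. t < h \<and> partial_deriv a u (x + s *\<^sub>R a + h *\<^sub>R b) - partial_deriv a u (x + s *\<^sub>R a + 0 *\<^sub>R b)
      = (h - 0) * partial_deriv b (partial_deriv a u) (x + s *\<^sub>R a + t *\<^sub>R b)"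
    using box s \<open>0 < h\<close> by (intro MVT2 C1_on_partial_has_derivative[OF C1(2) ab(2)]) auto
  then obtain t where t: "0 < t" "t < h"
    "partial_deriv a u (x + s *\<^sub>R a + h *\<^sub>R b) - partial_deriv a u (x + s *\<^sub>R a)
      = h * partial_deriv b (partial_deriv a u) (x + s *\<^sub>R a + t *\<^sub>R b)"
    by auto
  show thesis
    using that[OF s(1,2) t(1,2)] s(3) t(3) by (simp add: algebra_simps power2_eq_square)
qed

text \<open>
  If the two mixed derivatives differed at \<open>x\<close>, then by continuity all their values near \<open>x\<close> would
  differ; but both attain the same second difference quotient on any small parallelogram at \<open>x\<close>.
\<close>

lemma mixed_partials_commute:
  fixes u :: "'a::euclidean_space \<Rightarrow> real"
  assumes "open S" and u: "C2_on S u" and ab: "a \<in> Basis" "b \<in> Basis" and "x \<in> S"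
  shows "partial_deriv a (partial_deriv b u) x = partial_deriv b (partial_deriv a u) x"
proof (rule ccontr)
  let ?p = "partial_deriv a (partial_deriv b u)" and ?q = "partial_deriv b (partial_deriv a u)"
  define e where "e = dist (?p x) (?q x) / 2"
  assume "?p x \<noteq> ?q x"
  then have "e > 0" by (simp add: e_def)
  have "continuous_on S ?p" "continuous_on S ?q"
    using u ab unfolding C2_on_def C1_on_def by auto
  then have "isCont ?p x" "isCont ?q x"
    using \<open>open S\<close> \<open>x \<in> S\<close> by (auto simp: continuous_on_eq_continuous_at)
  then have "(?p \<longlongrightarrow> ?p x) (nhds x)" "(?q \<longlongrightarrow> ?q x) (nhds x)"
    unfolding isCont_def tendsto_at_iff_tendsto_nhds .
  then have "\<forall>\<^sub>F y in nhds x. dist (?p y) (?p x) < e \<and> dist (?q y) (?q x) < e \<and> y \<in> S"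
    by (intro eventually_conj tendstoD \<open>e > 0\<close> eventually_nhds_in_open \<open>open S\<close> \<open>x \<in> S\<close>)
  then obtain d where "d > 0"
    and d: "\<And>y. dist y x < d \<Longrightarrow> dist (?p y) (?p x) < e \<and> dist (?q y) (?q x) < e \<and> y \<in> S"
    unfolding eventually_nhds_metric by auto
  \<comment> \<open>Any \<open>h < d / 2\<close> keeps the parallelogram of side \<open>h\<close> within distance \<open>d\<close> of \<open>x\<close>.\<close>
  define h where "h = d / 3"
  have "h > 0" using \<open>d > 0\<close> by (simp add: h_def)
  have near: "dist (x + s *\<^sub>R v + t *\<^sub>R w) x < d"
    if "0 \<le> s" "s \<le> h" "0 \<le> t" "t \<le> h" "v \<in> Basis" "w \<in> Basis" for s t v w
  proof -
    have "norm (s *\<^sub>R v + t *\<^sub>R w) \<le> norm (s *\<^sub>R v) + norm (t *\<^sub>R w)" by (rule norm_triangle_ineq)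
    also have "\<dots> = s + t" using that by simp
    also have "\<dots> < d" using that \<open>d > 0\<close> by (simp add: h_def)
    finally show ?thesis by (simp add: dist_norm add.assoc)
  qed
  obtain s t where st: "0 < s" "s < h" "0 < t" "t < h"
    "u (x + h *\<^sub>R a + h *\<^sub>R b) - u (x + h *\<^sub>R a) - u (x + h *\<^sub>R b) + u x
      = h\<^sup>2 * ?q (x + s *\<^sub>R a + t *\<^sub>R b)"
    using second_difference_eq_mixed_partial[OF u ab \<open>h > 0\<close>] near d ab by metis
  obtain s' t' where st': "0 < s'" "s' < h" "0 < t'" "t' < h"
    "u (x + h *\<^sub>R b + h *\<^sub>R a) - u (x + h *\<^sub>R b) - u (x + h *\<^sub>R a) + u x
      = h\<^sup>2 * ?p (x + s' *\<^sub>R b + t' *\<^sub>R a)"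
    using second_difference_eq_mixed_partial[OF u ab(2,1) \<open>h > 0\<close>] near d ab by metis
  have "h\<^sup>2 * ?q (x + s *\<^sub>R a + t *\<^sub>R b) = h\<^sup>2 * ?p (x + s' *\<^sub>R b + t' *\<^sub>R a)"
    using st(5) st'(5) by (simp add: algebra_simps)
  then have "?q (x + s *\<^sub>R a + t *\<^sub>R b) = ?p (x + s' *\<^sub>R b + t' *\<^sub>R a)"
    using \<open>h > 0\<close> by simp
  moreover have "dist (?q (x + s *\<^sub>R a + t *\<^sub>R b)) (?q x) < e"
    using st ab by (intro d[THEN conjunct2, THEN conjunct1] near) auto
  moreover have "dist (?p (x + s' *\<^sub>R b + t' *\<^sub>R a)) (?p x) < e"
    using st' ab by (intro d[THEN conjunct1] near) auto
  ultimately have "dist (?p x) (?q x) < e + e"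
    using dist_triangle_less_add[of "?p x" "?p (x + s' *\<^sub>R b + t' *\<^sub>R a)" e "?q x" e]
    by (simp add: dist_commute)
  then show False
    by (simp add: e_def)
qed

lemma C1_on_imp_GDERIV:
  fixes u :: "complex \<Rightarrow> real"
  assumes "open S" and u: "C1_on S u" and "z \<in> S"
  shows "GDERIV u z :> gradient u z"
proof -
  obtain r where r: "r > 0" "ball z r \<subseteq> S"
    using assms openE by blast
  \<comment> \<open>On a rectangle around \<open>z\<close> inside \<open>S\<close> the two coordinates vary independently.\<close>
  define X where "X = {Re z - r/2<..<Re z + r/2}"
  define Y where "Y = {Im z - r/2<..<Im z + r/2}"
  have S: "Complex x y \<in> S" if "x \<in> X" "y \<in> Y" for x y
  proof -
    have "cmod (Complex x y - z) \<le> \<bar>x - Re z\<bar> + \<bar>y - Im z\<bar>"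
      using cmod_le[of "Complex x y - z"] by simp
    also have "\<dots> < r" using that by (auto simp: X_def Y_def abs_if)
    finally show ?thesis using r by (auto simp: dist_norm norm_minus_commute)
  qed
  have dx: "((\<lambda>x. u (Complex x (Im z))) has_real_derivative partial_deriv 1 u z) (at (Re z))"
    using C1_on_partial_has_derivative[OF u, of 1 "Complex 0 (Im z)" "Re z"] \<open>z \<in> S\<close>
    by (simp add: Complex_eq Basis_complex_def scaleR_conv_of_real add.commute complex_eq[symmetric] mult.commute)
  have dy: "((\<lambda>y. u (Complex x y)) has_real_derivative partial_deriv \<i> u (Complex x y)) (at y)"
    if "x \<in> X" "y \<in> Y" for x y
    using C1_on_partial_has_derivative[OF u, of \<i> "of_real x" y] S[OF that]
    by (simp add: Complex_eq Basis_complex_def scaleR_conv_of_real mult.commute)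
  have z: "(Re z, Im z) \<in> X \<times> Y" "open (X \<times> Y)" "open X" "open Y"
    using r by (auto simp: X_def Y_def intro!: open_Times)
  have C: "continuous_on (X \<times> Y) (\<lambda>(x, y). partial_deriv \<i> u (Complex x y))"
  proof -
    have "continuous_on S (partial_deriv \<i> u)"
      using u by (simp add: C1_on_def Basis_complex_def)
    moreover have "continuous_on (X \<times> Y) (\<lambda>p. complex_of_real (fst p) + \<i> * complex_of_real (snd p))"
      by (intro continuous_intros)
    then have "continuous_on (X \<times> Y) (\<lambda>p. Complex (fst p) (snd p))"
      by (simp add: Complex_eq)
    ultimately show ?thesis
      unfolding case_prod_unfold by (rule continuous_on_compose2) (auto intro: S)
  qed
  have "((\<lambda>(x, y). u (Complex x y)) has_derivative
      (\<lambda>(tx, ty). tx * partial_deriv 1 u z + blinfun_scaleR_left (partial_deriv \<i> u (Complex (Re z) (Im z))) ty))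
      (at (Re z, Im z) within X \<times> Y)"
  proof (rule has_derivative_partialsI[where fy = "\<lambda>x y. blinfun_scaleR_left (partial_deriv \<i> u (Complex x y))"])
    show "((\<lambda>x. u (Complex x (Im z))) has_derivative (\<lambda>t. t * partial_deriv 1 u z)) (at (Re z) within X)"
      using dx by (auto simp: has_field_derivative_def mult.commute[of _ "partial_deriv 1 u z"] intro: has_derivative_at_withinI)
    show "((\<lambda>y. u (Complex x y)) has_derivative blinfun_apply (blinfun_scaleR_left (partial_deriv \<i> u (Complex x y))))
        (at y within Y)" if "x \<in> X" "y \<in> Y" for x y
      using dy[OF that]
      by (auto simp: has_field_derivative_def mult.commute[of _ "partial_deriv \<i> u _"] intro!: has_derivative_at_withinI
            elim!: has_derivative_eq_rhs)
    have "continuous_on (X \<times> Y) (\<lambda>(x, y). blinfun_scaleR_left (partial_deriv \<i> u (Complex x y)) :: real \<Rightarrow>\<^sub>L real)"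
      using C by (auto simp: case_prod_unfold intro!: bounded_linear.continuous_on[OF bounded_linear_blinfun_scaleR_left])
    then show "continuous (at (Re z, Im z) within X \<times> Y) (\<lambda>(x, y). blinfun_scaleR_left (partial_deriv \<i> u (Complex x y)) :: real \<Rightarrow>\<^sub>L real)"
      using z by (auto simp: continuous_on_eq_continuous_within)
  qed (use z in \<open>auto simp: Y_def\<close>)
  then have 1: "((\<lambda>(x, y). u (Complex x y)) has_derivative
      (\<lambda>(tx, ty). tx * partial_deriv 1 u z + ty * partial_deriv \<i> u z)) (at (Re z, Im z))"
    unfolding at_within_open[OF z(1,2)] by simp
  have 2: "((\<lambda>w. (Re w, Im w)) has_derivative (\<lambda>w. (Re w, Im w))) (at z)"
    by (intro derivative_intros)
  have "((\<lambda>w. (\<lambda>(x, y). u (Complex x y)) (Re w, Im w)) has_derivative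
      (\<lambda>w. (\<lambda>(tx, ty). tx * partial_deriv 1 u z + ty * partial_deriv \<i> u z) (Re w, Im w))) (at z)"
    using has_derivative_compose[OF 2 1] .
  then show ?thesis
    by (simp add: gderiv_def gradient_complex inner_complex_def)
qed

section \<open>Harmonic functions in the plane as real parts of holomorphic functions\<close>

text \<open>
  For \<open>u\<^sub>x - \<i> u\<^sub>y\<close>, one Cauchy--Riemann equation is that the Laplacian of \<open>u\<close> vanishes, the other
  that the mixed second derivatives are equal.
\<close>

lemma harmonic_gradient_holomorphic:
  fixes u :: "complex \<Rightarrow> real"
  assumes "harmonic_on S u"
  shows "(\<lambda>z. cnj (gradient u z)) holomorphic_on S"
proof -
  have "open S" and u: "C2_on S u" and lap: "\<And>z. z \<in> S \<Longrightarrow> laplacian u z = 0"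
    using assms by (auto simp: harmonic_on_def)
  have "(\<lambda>z. cnj (gradient u z)) field_differentiable (at z)" if "z \<in> S" for z
  proof -
    let ?x = "partial_deriv 1 u" and ?y = "partial_deriv \<i> u"
    let ?c = "Complex (partial_deriv 1 ?x z) (- partial_deriv 1 ?y z)"
    have "GDERIV ?x z :> gradient ?x z" "GDERIV ?y z :> gradient ?y z"
      using u \<open>open S\<close> that by (auto intro!: C1_on_imp_GDERIV simp: C2_on_def Basis_complex_def)
    then have "((\<lambda>w. complex_of_real (?x w) - \<i> * complex_of_real (?y w)) has_derivative
        (\<lambda>h. complex_of_real (h \<bullet> gradient ?x z) - \<i> * complex_of_real (h \<bullet> gradient ?y z))) (at z)"
      unfolding gderiv_def by (intro derivative_intros)
    moreover have "partial_deriv \<i> ?x z = partial_deriv 1 ?y z"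
      using mixed_partials_commute[OF \<open>open S\<close> u, of \<i> 1] that by (simp add: Basis_complex_def)
    moreover have "partial_deriv \<i> ?y z = - partial_deriv 1 ?x z"
      using lap[OF that] by (simp add: laplacian_complex)
    ultimately have "((\<lambda>w. complex_of_real (?x w) - \<i> * complex_of_real (?y w)) has_derivative
        (\<lambda>h. ?c * h)) (at z)"
      by (elim has_derivative_eq_rhs)
        (auto simp: fun_eq_iff complex_eq_iff gradient_complex inner_complex_def algebra_simps)
    moreover have "complex_of_real (?x w) - \<i> * complex_of_real (?y w) = cnj (gradient u w)" for w
      by (simp add: gradient_complex complex_eq_iff)
    ultimately show ?thesis
      unfolding field_differentiable_def has_field_derivative_def by auto
  qed
  then show ?thesis
    using \<open>open S\<close> by (simp add: holomorphic_on_open field_differentiable_def)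
qed

text \<open>
  Take a primitive of the holomorphic function \<open>u\<^sub>x - \<i> u\<^sub>y\<close>: its real part has the same gradient as
  \<open>u\<close>, hence differs from it by a constant.
\<close>

lemma harmonic_eq_Re_holomorphic:
  fixes u :: "complex \<Rightarrow> real"
  assumes u: "harmonic_on S u" and "convex S"
  obtains f where "\<And>z. z \<in> S \<Longrightarrow> u z = Re (f z)"
    and "\<And>z. z \<in> S \<Longrightarrow> (f has_field_derivative cnj (gradient u z)) (at z)"
proof -
  have "open S" and C1: "C1_on S u"
    using u by (auto simp: harmonic_on_def C2_on_def)
  obtain f where "\<And>z. z \<in> S \<Longrightarrow> (f has_field_derivative cnj (gradient u z)) (at z within S)"
    using holomorphic_convex_primitive'[OF \<open>convex S\<close> \<open>open S\<close> harmonic_gradient_holomorphic[OF u]] by metis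
  then have f: "(f has_field_derivative cnj (gradient u z)) (at z)" if "z \<in> S" for z
    using that at_within_open[OF that \<open>open S\<close>] by metis
  have "((\<lambda>w. u w - Re (f w)) has_derivative (\<lambda>h. 0)) (at z within S)" if "z \<in> S" for z
  proof -
    have "(u has_derivative (\<lambda>h. h \<bullet> gradient u z)) (at z)"
      using C1_on_imp_GDERIV[OF \<open>open S\<close> C1 that] by (simp add: gderiv_def)
    moreover have "(f has_derivative (\<lambda>h. cnj (gradient u z) * h)) (at z)"
      using f[OF that] by (simp add: has_field_derivative_def)
    ultimately have "((\<lambda>w. u w - Re (f w)) has_derivative
        (\<lambda>h. h \<bullet> gradient u z - Re (cnj (gradient u z) * h))) (at z)"
      by (intro derivative_intros)
    then show ?thesis
      by (auto simp: inner_complex_def algebra_simps intro: has_derivative_at_withinI)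
  qed
  then have "\<exists>c. \<forall>z\<in>S. u z - Re (f z) = c"
    by (rule has_derivative_zero_constant[OF \<open>convex S\<close>])
  then obtain c where c: "\<And>z. z \<in> S \<Longrightarrow> u z - Re (f z) = c"
    by blast
  show thesis
  proof
    show "u z = Re (f z + of_real c)" if "z \<in> S" for z
      using c[OF that] by simp
    show "((\<lambda>z. f z + of_real c) has_field_derivative cnj (gradient u z)) (at z)" if "z \<in> S" for z
      using f[OF that] by (auto intro!: derivative_eq_intros)
  qed
qed

lemma DERIV_Re_along_line:
  assumes "f holomorphic_on S" "open S" "x \<in> S"
  shows "((\<lambda>t. Re (f (x + t *\<^sub>R b))) has_real_derivative Re (b * deriv f x)) (at 0)"
proof -
  have "(f has_derivative (\<lambda>h. deriv f x * h)) (at (x + 0 *\<^sub>R b))"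
    using holomorphic_derivI[OF assms] by (simp add: has_field_derivative_def)
  moreover have "((\<lambda>t::real. x + t *\<^sub>R b) has_derivative (\<lambda>t. t *\<^sub>R b)) (at 0)"
    by (auto intro!: derivative_eq_intros)
  ultimately have "((\<lambda>t. f (x + t *\<^sub>R b)) has_derivative (\<lambda>t. deriv f x * (t *\<^sub>R b))) (at 0)"
    by (rule has_derivative_compose[rotated])
  then have "((\<lambda>t. Re (f (x + t *\<^sub>R b))) has_derivative (\<lambda>t. Re (deriv f x * (t *\<^sub>R b)))) (at 0)"
    by (rule has_derivative_Re)
  then show ?thesis
    by (auto simp: has_field_derivative_def algebra_simps elim!: has_derivative_eq_rhs)
qed

lemma DERIV_along_line_cong:
  fixes u v :: "'a::euclidean_space \<Rightarrow> real"
  assumes "open S" "x \<in> S" "\<And>y. y \<in> S \<Longrightarrow> u y = v y"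
  shows "((\<lambda>t. u (x + t *\<^sub>R b)) has_real_derivative D) (at 0) \<longleftrightarrow>
         ((\<lambda>t. v (x + t *\<^sub>R b)) has_real_derivative D) (at 0)"
proof (rule DERIV_cong_ev)
  have "((\<lambda>t::real. x + t *\<^sub>R b) \<longlongrightarrow> x + 0 *\<^sub>R b) (nhds 0)"
    by (intro tendsto_intros filterlim_ident)
  then have "\<forall>\<^sub>F t in nhds (0::real). x + t *\<^sub>R b \<in> S"
    using assms by (intro topological_tendstoD) auto
  then show "\<forall>\<^sub>F t in nhds (0::real). u (x + t *\<^sub>R b) = v (x + t *\<^sub>R b)"
    by eventually_elim (use assms in auto)
qed auto

text \<open>
  The function \<open>u\<close> is related to \<open>f\<close> only on \<open>S\<close>, so that the lemma also applies to a partial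
  derivative of \<open>Re f\<close>, whose values are known on \<open>S\<close> only.
\<close>

lemma DERIV_along_line_if_eq_Re_holomorphic:
  assumes "f holomorphic_on S" "open S" "x \<in> S" "\<And>z. z \<in> S \<Longrightarrow> u z = Re (f z)"
  shows "((\<lambda>t. u (x + t *\<^sub>R b)) has_real_derivative Re (b * deriv f x)) (at 0)"
  using DERIV_along_line_cong[OF assms(2,3), of u "\<lambda>z. Re (f z)"] DERIV_Re_along_line[OF assms(1-3)] assms(4)
  by blast

lemma partial_deriv_eq_Re:
  assumes "f holomorphic_on S" "open S" "x \<in> S" "\<And>z. z \<in> S \<Longrightarrow> u z = Re (f z)"
  shows "partial_deriv b u x = Re (b * deriv f x)"
  unfolding partial_deriv_def
  by (rule DERIV_imp_deriv[OF DERIV_along_line_if_eq_Re_holomorphic[OF assms]])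

lemma C1_on_if_eq_Re_holomorphic:
  assumes f: "f holomorphic_on S" "open S" and u: "\<And>z. z \<in> S \<Longrightarrow> u z = Re (f z)"
  shows "C1_on S u"
  unfolding C1_on_def
proof (intro ballI conjI)
  fix b x :: complex
  assume "x \<in> S"
  show "(\<lambda>t. u (x + t *\<^sub>R b)) differentiable (at 0)"
    using DERIV_along_line_if_eq_Re_holomorphic[OF f \<open>x \<in> S\<close> u] real_differentiable_def by blast
next
  fix b :: complex
  have "continuous_on S (\<lambda>x. Re (b * deriv f x))"
    using f by (intro continuous_intros holomorphic_on_imp_continuous_on holomorphic_deriv)
  then show "continuous_on S (partial_deriv b u)"
    by (rule continuous_on_eq) (simp add: partial_deriv_eq_Re[OF f _ u])
qed

text \<open>
  A partial derivative of \<open>Re f\<close> in direction \<open>b\<close> is the real part of the holomorphic function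
  \<open>b f'\<close>. Iterating, the Laplacian is \<open>Re ((1\<^sup>2 + \<i>\<^sup>2) f'') = 0\<close>.
\<close>

lemma harmonic_on_if_eq_Re_holomorphic:
  assumes f: "f holomorphic_on S" "open S" and u: "\<And>z. z \<in> S \<Longrightarrow> u z = Re (f z)"
  shows "harmonic_on S u"
  unfolding harmonic_on_def C2_on_def
proof (intro conjI ballI)
  have f': "(\<lambda>z. b * deriv f z) holomorphic_on S" for b
    using f by (intro holomorphic_intros holomorphic_deriv)
  have pd: "partial_deriv b u z = Re (b * deriv f z)" if "z \<in> S" for b z
    by (rule partial_deriv_eq_Re[OF f that u])
  show "C1_on S u" by (rule C1_on_if_eq_Re_holomorphic[OF f u])
  show "C1_on S (partial_deriv b u)" for b
    by (rule C1_on_if_eq_Re_holomorphic[OF f' \<open>open S\<close> pd])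
  show "laplacian u z = 0" if "z \<in> S" for z
  proof -
    have "deriv (\<lambda>z. b * deriv f z) z = b * deriv (deriv f) z" for b
      using f that by (intro deriv_cmult holomorphic_on_imp_differentiable_at[of _ S] holomorphic_deriv) auto
    then show ?thesis
      by (simp add: laplacian_complex partial_deriv_eq_Re[OF f' \<open>open S\<close> that pd])
  qed
qed fact

lemma gradient_eq_cnj_deriv:
  assumes "f holomorphic_on S" "open S" "z \<in> S" "\<And>z. z \<in> S \<Longrightarrow> u z = Re (f z)"
  shows "gradient u z = cnj (deriv f z)"
  by (simp add: gradient_complex partial_deriv_eq_Re[OF assms] complex_eq_iff)

section \<open>The Schwarz--Pick lemma for the disk and for a strip\<close>

text \<open>
  Moebius transformations of the disk moving \<open>0\<close> to \<open>z\<close> and \<open>f z\<close> to \<open>0\<close> reduce this to the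
  Schwarz lemma at the origin.
\<close>

lemma Schwarz_Pick_deriv:
  assumes f: "f holomorphic_on ball 0 1" and f1: "\<And>z. norm z < 1 \<Longrightarrow> norm (f z) < 1"
    and z: "norm z < 1"
  shows "norm (deriv f z) \<le> (1 - (norm (f z))\<^sup>2) / (1 - (norm z)\<^sup>2)"
proof -
  define w where "w = f z"
  define \<phi> where "\<phi> = Moebius_function 0 (- z)"
  define \<psi> where "\<psi> = Moebius_function 0 w"
  have w: "norm w < 1" using f1[OF z] by (simp add: w_def)
  have pos: "1 - (norm z)\<^sup>2 > 0" "1 - (norm w)\<^sup>2 > 0"
    using z w by (simp_all add: abs_square_less_1)
  have nz: "of_real (1 - (norm w)\<^sup>2) \<noteq> (0::complex)"
    using pos unfolding of_real_eq_0_iff by linarith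
  have sq: "1 - cnj v * v = of_real (1 - (norm v)\<^sup>2)" for v
    by (metis complex_norm_square mult.commute of_real_1 of_real_diff)
  have \<phi>0: "\<phi> 0 = z" and \<psi>w: "\<psi> w = 0"
    by (simp_all add: \<phi>_def \<psi>_def Moebius_function_of_zero Moebius_function_eq_zero)
  have \<phi>': "(\<phi> has_field_derivative of_real (1 - (norm z)\<^sup>2)) (at 0)"
    unfolding \<phi>_def Moebius_function_simple sq[symmetric]
    by (auto intro!: derivative_eq_intros simp: mult.commute)
  have \<psi>': "(\<psi> has_field_derivative inverse (of_real (1 - (norm w)\<^sup>2))) (at w)"
  proof -
    define c where "c = 1 - cnj w * w"
    have "c \<noteq> 0" using nz by (simp add: c_def sq)
    then have "((\<lambda>z. (z - w) / (1 - cnj w * z)) has_field_derivative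
        (1 * c - (w - w) * (- cnj w)) / (c * c)) (at w)"
      unfolding c_def by (auto intro!: derivative_eq_intros)
    then show ?thesis
      using \<open>c \<noteq> 0\<close> unfolding \<psi>_def Moebius_function_simple sq[symmetric] c_def[symmetric]
      by (simp add: inverse_eq_divide)
  qed
  have f': "(f has_field_derivative deriv f z) (at z)"
    using holomorphic_derivI[OF f] z by simp
  have "((\<lambda>x. f (\<phi> x)) has_field_derivative deriv f z * of_real (1 - (norm z)\<^sup>2)) (at 0)"
    using DERIV_chain2[of f _ \<phi> 0] f' \<phi>' by (simp add: \<phi>0)
  then have "((\<lambda>x. \<psi> (f (\<phi> x))) has_field_derivative
      inverse (of_real (1 - (norm w)\<^sup>2)) * (deriv f z * of_real (1 - (norm z)\<^sup>2))) (at 0)"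
    using DERIV_chain2[of \<psi> _ "\<lambda>x. f (\<phi> x)" 0] \<psi>' by (simp add: \<phi>0 w_def[symmetric])
  then have d: "deriv (\<lambda>x. \<psi> (f (\<phi> x))) 0
      = inverse (of_real (1 - (norm w)\<^sup>2)) * (deriv f z * of_real (1 - (norm z)\<^sup>2))"
    by (rule DERIV_imp_deriv)
  have \<phi>1: "norm (\<phi> x) < 1" and \<psi>1: "norm (\<psi> x) < 1" if "norm x < 1" for x
    using that z w by (simp_all add: \<phi>_def \<psi>_def Moebius_function_norm_lt_1)
  have holf: "(f \<circ> \<phi>) holomorphic_on ball 0 1"
    using z \<phi>1 by (intro holomorphic_on_compose_gen[OF _ f]) (auto simp: \<phi>_def intro: Moebius_function_holomorphic)
  then have "(\<psi> \<circ> (f \<circ> \<phi>)) holomorphic_on ball 0 1"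
    using w f1 \<phi>1 by (intro holomorphic_on_compose_gen[where g = \<psi> and t = "ball 0 1"])
      (auto simp: \<psi>_def intro: Moebius_function_holomorphic)
  then have hol: "(\<lambda>x. \<psi> (f (\<phi> x))) holomorphic_on ball 0 1"
    by (simp add: o_def)
  have "norm (deriv (\<lambda>x. \<psi> (f (\<phi> x))) 0) \<le> 1"
    by (rule Schwarz_Lemma(2)[OF hol, of 0]) (use \<phi>1 \<psi>1 f1 in \<open>auto simp: \<phi>0 w_def[symmetric] \<psi>w\<close>)
  moreover have "norm (deriv (\<lambda>x. \<psi> (f (\<phi> x))) 0)
      = norm (deriv f z) * (1 - (norm z)\<^sup>2) / (1 - (norm w)\<^sup>2)"
    unfolding d norm_mult norm_inverse norm_of_real using pos by (simp add: field_simps)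
  ultimately show ?thesis
    using pos by (simp add: w_def field_simps)
qed

text \<open>
  This is what makes \<open>tan\<close> map the strip \<open>\<bar>Re z\<bar> < \<pi>/4\<close> into the unit disk, and also what turns
  \<open>1 - \<bar>tan z\<bar>\<^sup>2\<close> into a function of \<open>Re z\<close> divided by \<open>\<bar>cos z\<bar>\<^sup>2\<close>.
\<close>

lemma norm_cos_squared_minus_norm_sin_squared:
  "(norm (cos z))\<^sup>2 - (norm (sin z))\<^sup>2 = cos (2 * Re z)" for z :: complex
proof -
  have "exp (2 * Im z) = (exp (Im z))\<^sup>2" by (rule exp_double)
  then show ?thesis
    unfolding norm_cos_squared norm_sin_squared cos_double_cos
    by (simp add: field_simps power2_eq_square)
qed

text \<open>
  Apply the Schwarz--Pick lemma to \<open>tan (\<pi> f / 4)\<close>. The factor \<open>\<bar>cos (\<pi> f / 4)\<bar>\<^bsup>-2\<^esup>\<close> coming from the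
  derivative of \<open>tan\<close> also occurs in \<open>1 - \<bar>tan (\<pi> f / 4)\<bar>\<^sup>2\<close> and cancels, which leaves a bound
  in terms of \<open>Re f\<close>.
\<close>

lemma Schwarz_Pick_strip:
  assumes f: "f holomorphic_on ball 0 1" and strip: "\<And>z. norm z < 1 \<Longrightarrow> \<bar>Re (f z)\<bar> < 1"
    and z: "norm z < 1"
  shows "norm (deriv f z) \<le> 4 / pi * (cos (pi / 2 * Re (f z)) / (1 - (norm z)\<^sup>2))"
proof -
  define g where "g = (\<lambda>z. of_real (pi / 4) * f z)"
  have cs: "(norm (cos (g x)))\<^sup>2 - (norm (sin (g x)))\<^sup>2 = cos (pi / 2 * Re (f x))" for x
    unfolding norm_cos_squared_minus_norm_sin_squared by (simp add: g_def)
  have pos: "cos (pi / 2 * Re (f x)) > 0" if "norm x < 1" for x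
  proof (rule cos_gt_zero_pi)
    have "pi / 2 * \<bar>Re (f x)\<bar> < pi / 2 * 1"
      using strip[OF that] by (intro mult_strict_left_mono) auto
    then have "\<bar>pi / 2 * Re (f x)\<bar> < pi / 2"
      by (simp add: abs_mult)
    then show "- (pi / 2) < pi / 2 * Re (f x)" "pi / 2 * Re (f x) < pi / 2"
      unfolding abs_less_iff by linarith+
  qed
  have lt: "norm (sin (g x)) < norm (cos (g x))" if "norm x < 1" for x
  proof (rule power2_less_imp_less)
    show "(norm (sin (g x)))\<^sup>2 < (norm (cos (g x)))\<^sup>2"
      using cs[of x] pos[OF that] by linarith
  qed simp
  have nz: "cos (g x) \<noteq> 0" if "norm x < 1" for x
    using lt[OF that] by auto
  have hol: "(\<lambda>x. tan (g x)) holomorphic_on ball 0 1"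
    unfolding tan_def g_def using nz by (intro holomorphic_intros f) (auto simp: g_def)
  have "norm (tan (g x)) < 1" if "norm x < 1" for x
    using lt[OF that] nz[OF that] by (simp add: tan_def norm_divide)
  from Schwarz_Pick_deriv[OF hol this z]
  have SP: "norm (deriv (\<lambda>x. tan (g x)) z) \<le> (1 - (norm (tan (g z)))\<^sup>2) / (1 - (norm z)\<^sup>2)" .
  have "(g has_field_derivative of_real (pi / 4) * deriv f z) (at z)"
    unfolding g_def using holomorphic_derivI[OF f] z by (auto intro!: derivative_eq_intros)
  then have "((\<lambda>x. tan (g x)) has_field_derivative
      inverse ((cos (g z))\<^sup>2) * (of_real (pi / 4) * deriv f z)) (at z)"
    by (rule DERIV_chain2[where f = tan and g = g, OF DERIV_tan[OF nz[OF z]]])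
  then have deriv: "deriv (\<lambda>x. tan (g x)) z = inverse ((cos (g z))\<^sup>2) * (of_real (pi / 4) * deriv f z)"
    by (rule DERIV_imp_deriv)
  have d: "norm (deriv (\<lambda>x. tan (g x)) z) = pi / 4 * norm (deriv f z) / (norm (cos (g z)))\<^sup>2"
    unfolding deriv norm_mult norm_inverse norm_power norm_of_real by (simp add: inverse_eq_divide)
  have t: "1 - (norm (tan (g z)))\<^sup>2 = cos (pi / 2 * Re (f z)) / (norm (cos (g z)))\<^sup>2"
    unfolding cs[symmetric] using nz[OF z] by (simp add: tan_def norm_divide field_simps)
  have "pi / 4 * norm (deriv f z) / (norm (cos (g z)))\<^sup>2
      \<le> (cos (pi / 2 * Re (f z)) / (1 - (norm z)\<^sup>2)) / (norm (cos (g z)))\<^sup>2"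
    using SP unfolding d t divide_divide_eq_left by (simp only: mult.commute)
  moreover have "(norm (cos (g z)))\<^sup>2 > 0"
    using nz[OF z] by simp
  ultimately have "pi / 4 * norm (deriv f z) \<le> cos (pi / 2 * Re (f z)) / (1 - (norm z)\<^sup>2)"
    by (metis divide_le_cancel order.asym)
  then have "4 / pi * (pi / 4 * norm (deriv f z)) \<le> 4 / pi * (cos (pi / 2 * Re (f z)) / (1 - (norm z)\<^sup>2))"
    by (rule mult_left_mono) simp
  then show ?thesis by simp
qed

text \<open>
  Since \<open>1 - cos (\<pi> x / 2) = 2 sin\<^sup>2 (\<pi> x / 4)\<close>, the claim is that the concave function
  \<open>sin\<close> lies above its chord over \<open>[0, \<pi>/4]\<close>.
\<close>

lemma cos_half_pi_le:
  fixes x :: real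
  assumes "\<bar>x\<bar> \<le> 1"
  shows "cos (pi / 2 * x) \<le> 1 - x\<^sup>2"
proof -
  have conc: "concave_on {0..pi/4} (sin :: real \<Rightarrow> real)"
  proof (rule f''_le0_imp_concave[where f' = cos and f'' = "\<lambda>x. - sin x"])
    show "- sin y \<le> (0::real)" if "y \<in> {0..pi/4}" for y
      using that pi_gt_zero by (auto intro!: sin_ge_zero)
  qed (auto intro!: derivative_eq_intros)
  have "(1 - \<bar>x\<bar>) * sin 0 + \<bar>x\<bar> * sin (pi/4) \<le> sin ((1 - \<bar>x\<bar>) *\<^sub>R 0 + \<bar>x\<bar> *\<^sub>R (pi/4))"
    using assms by (intro concave_onD[OF conc]) auto
  then have "\<bar>x\<bar> * (sqrt 2 / 2) \<le> sin (pi / 4 * \<bar>x\<bar>)"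
    by (simp add: sin_45 mult.commute)
  then have "(\<bar>x\<bar> * (sqrt 2 / 2))\<^sup>2 \<le> (sin (pi / 4 * \<bar>x\<bar>))\<^sup>2"
    by (rule power_mono) auto
  then have "x\<^sup>2 \<le> 2 * (sin (pi / 4 * \<bar>x\<bar>))\<^sup>2"
    by (simp add: power_mult_distrib power_divide)
  also have "\<dots> = 1 - cos (pi / 2 * \<bar>x\<bar>)"
    using cos_double_sin[of "pi / 4 * \<bar>x\<bar>"] by simp
  also have "cos (pi / 2 * \<bar>x\<bar>) = cos (pi / 2 * x)"
    by (cases "x \<ge> 0") auto
  finally show ?thesis by simp
qed

section \<open>The gradient of a harmonic function with values in an interval\<close>

lemma harmonic_strip_gradient_bound:
  fixes u :: "complex \<Rightarrow> real"
  assumes "\<alpha> < \<beta>" and u: "harmonic_on unit_disk u" "u ` unit_disk \<subseteq> {\<alpha><..<\<beta>}" and z: "z \<in> unit_disk"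
  shows "norm (gradient u z) \<le> 2 * (\<beta> - \<alpha>) / pi *
    ((1 - 4 / (\<beta> - \<alpha>)\<^sup>2 * \<bar>u z - (\<alpha> + \<beta>) / 2\<bar>\<^sup>2) / (1 - (norm z)\<^sup>2))"
proof -
  obtain f where f: "\<And>z. z \<in> unit_disk \<Longrightarrow> u z = Re (f z)"
    "\<And>z. z \<in> unit_disk \<Longrightarrow> (f has_field_derivative cnj (gradient u z)) (at z)"
    using harmonic_eq_Re_holomorphic[OF u(1) convex_ball] by metis
  define F where "F = (\<lambda>z. of_real (2 / (\<beta> - \<alpha>)) * (f z - of_real ((\<alpha> + \<beta>) / 2)))"
  have F': "(F has_field_derivative of_real (2 / (\<beta> - \<alpha>)) * cnj (gradient u x)) (at x)"
    if "x \<in> unit_disk" for x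
    unfolding F_def by (rule DERIV_cmult) (use f(2)[OF that] in \<open>auto intro!: derivative_eq_intros\<close>)
  have ReF: "Re (F x) = 2 / (\<beta> - \<alpha>) * (u x - (\<alpha> + \<beta>) / 2)" if "x \<in> unit_disk" for x
    by (simp only: F_def times_complex.sel Re_complex_of_real Im_complex_of_real
        minus_complex.sel f(1)[OF that])
  have strip: "\<bar>Re (F x)\<bar> < 1" if "norm x < 1" for x
  proof -
    have x: "x \<in> unit_disk" using that by simp
    then have "\<alpha> < u x" "u x < \<beta>" using u(2) by (auto simp: image_subset_iff)
    then show ?thesis
      unfolding ReF[OF x] abs_less_iff using \<open>\<alpha> < \<beta>\<close> by (simp add: field_simps)
  qed
  have hol: "F holomorphic_on unit_disk"
    unfolding holomorphic_on_open[OF open_ball] using F' by blast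
  have nz: "norm z < 1" using z by simp
  have "norm (deriv F z) = 2 / (\<beta> - \<alpha>) * norm (gradient u z)"
    unfolding DERIV_imp_deriv[OF F'[OF z]] norm_mult complex_mod_cnj norm_of_real using \<open>\<alpha> < \<beta>\<close> by simp
  then have "norm (gradient u z) = (\<beta> - \<alpha>) / 2 * norm (deriv F z)"
    using \<open>\<alpha> < \<beta>\<close> by simp
  also have "\<dots> \<le> (\<beta> - \<alpha>) / 2 * (4 / pi * (cos (pi / 2 * Re (F z)) / (1 - (norm z)\<^sup>2)))"
    using \<open>\<alpha> < \<beta>\<close> by (intro mult_left_mono Schwarz_Pick_strip[OF hol strip nz]) auto
  also have "\<dots> \<le> (\<beta> - \<alpha>) / 2 * (4 / pi * ((1 - (Re (F z))\<^sup>2) / (1 - (norm z)\<^sup>2)))"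
    using \<open>\<alpha> < \<beta>\<close> strip[OF nz] nz
    by (intro mult_left_mono divide_right_mono cos_half_pi_le) (auto simp: abs_square_le_1)
  also have "(Re (F z))\<^sup>2 = 4 / (\<beta> - \<alpha>)\<^sup>2 * \<bar>u z - (\<alpha> + \<beta>) / 2\<bar>\<^sup>2"
    unfolding ReF[OF z] power_mult_distrib power_divide power2_abs by simp
  finally have "norm (gradient u z) \<le> (\<beta> - \<alpha>) / 2 * (4 / pi *
      ((1 - 4 / (\<beta> - \<alpha>)\<^sup>2 * \<bar>u z - (\<alpha> + \<beta>) / 2\<bar>\<^sup>2) / (1 - (norm z)\<^sup>2)))" .
  moreover have "(\<beta> - \<alpha>) / 2 * (4 / pi * q) = 2 * (\<beta> - \<alpha>) / pi * q" for q :: real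
    by simp
  ultimately show ?thesis
    by (simp only:)
qed

lemma Re_Cayley_pos:
  assumes "norm z < 1"
  shows "Re ((1 + z) / (1 - z)) > 0"
proof -
  have "(Re z)\<^sup>2 + (Im z)\<^sup>2 < 1"
    using assms by (simp add: cmod_power2[symmetric] abs_square_less_1)
  moreover have "1 - z \<noteq> 0" using assms by auto
  moreover have "Re ((1 + z) / (1 - z)) = (1 - ((Re z)\<^sup>2 + (Im z)\<^sup>2)) / (norm (1 - z))\<^sup>2"
    unfolding Re_divide cmod_power2 by (simp add: algebra_simps power2_eq_square)
  ultimately show ?thesis by simp
qed

text \<open>
  The Cayley transform \<open>(1 + z) / (1 - z)\<close> maps the disk onto the right half plane, which \<open>Ln\<close> maps
  onto the horizontal strip \<open>\<bar>Im w\<bar> < \<pi>/2\<close>; the factor \<open>- \<i> (\<beta> - \<alpha>) / \<pi>\<close> turns it upright and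
  gives it the width \<open>\<beta> - \<alpha>\<close>.
\<close>

lemma strip_gradient_bound_attained:
  assumes "\<alpha> < \<beta>"
  obtains u :: "complex \<Rightarrow> real" where "harmonic_on unit_disk u" "u ` unit_disk \<subseteq> {\<alpha><..<\<beta>}"
    "u 0 = (\<alpha> + \<beta>) / 2" "norm (gradient u 0) = 2 * (\<beta> - \<alpha>) / pi"
proof -
  define c where "c = (\<beta> - \<alpha>) / pi"
  have "c > 0" using assms by (simp add: c_def)
  define f where "f = (\<lambda>z. of_real ((\<alpha> + \<beta>) / 2) - \<i> * of_real c * Ln ((1 + z) / (1 - z)))"
  define u where "u = (\<lambda>z. Re (f z))"
  have nz: "1 - z \<noteq> 0" if "z \<in> unit_disk" for z :: complex
    using that by auto
  have nonpos: "(1 + z) / (1 - z) \<notin> \<real>\<^sub>\<le>\<^sub>0" if "z \<in> unit_disk" for z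
    using Re_Cayley_pos[of z] that by (auto simp: complex_nonpos_Reals_iff)
  have hol: "f holomorphic_on unit_disk"
    unfolding f_def by (intro holomorphic_intros nz nonpos)
  have Re_f: "u z = (\<alpha> + \<beta>) / 2 + c * Im (Ln ((1 + z) / (1 - z)))" for z
    by (simp add: u_def f_def)
  have "(f has_field_derivative - 2 * \<i> * of_real c) (at 0)"
    unfolding f_def by (auto intro!: derivative_eq_intros)
  then have "deriv f 0 = - 2 * \<i> * of_real c" by (rule DERIV_imp_deriv)
  moreover have "gradient u 0 = cnj (deriv f 0)"
    by (rule gradient_eq_cnj_deriv[OF hol]) (auto simp: u_def)
  ultimately have "norm (gradient u 0) = 2 * c"
    using \<open>c > 0\<close> by (simp add: norm_mult)
  then have "norm (gradient u 0) = 2 * (\<beta> - \<alpha>) / pi"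
    by (simp add: c_def)
  moreover have "harmonic_on unit_disk u"
    by (rule harmonic_on_if_eq_Re_holomorphic[OF hol]) (auto simp: u_def)
  moreover have "u ` unit_disk \<subseteq> {\<alpha><..<\<beta>}"
  proof (rule image_subsetI)
    fix z :: complex
    assume "z \<in> unit_disk"
    then have pos: "Re ((1 + z) / (1 - z)) > 0" by (intro Re_Cayley_pos) simp
    then have "(1 + z) / (1 - z) \<noteq> 0" by auto
    then have "\<bar>Im (Ln ((1 + z) / (1 - z)))\<bar> < pi / 2"
      using pos Re_Ln_pos_lt by blast
    then have "\<bar>c * Im (Ln ((1 + z) / (1 - z)))\<bar> < c * (pi / 2)"
      using \<open>c > 0\<close> unfolding abs_mult by simp
    moreover have "c * (pi / 2) = (\<beta> - \<alpha>) / 2" by (simp add: c_def)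
    ultimately have "\<bar>u z - (\<alpha> + \<beta>) / 2\<bar> < (\<beta> - \<alpha>) / 2"
      unfolding Re_f by simp
    then show "u z \<in> {\<alpha><..<\<beta>}"
      unfolding abs_less_iff by (simp add: field_simps)
  qed
  moreover have "u 0 = (\<alpha> + \<beta>) / 2" by (simp add: Re_f)
  ultimately show thesis using that by blast
qed

theorem theorem4p5:
  fixes \<alpha> \<beta> :: real
  assumes "\<alpha> < \<beta>"
  shows "(\<forall>u :: complex \<Rightarrow> real.
            harmonic_on unit_disk u \<longrightarrow> u ` unit_disk \<subseteq> {\<alpha><..<\<beta>} \<longrightarrow>
            (\<forall>z\<in>unit_disk.
               norm (gradient u z) \<le> 2 * (\<beta> - \<alpha>) / pi *
                 ((1 - 4 / (\<beta> - \<alpha>)\<^sup>2 * \<bar>u z - (\<alpha> + \<beta>) / 2\<bar>\<^sup>2) / (1 - (norm z)\<^sup>2))))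
       \<and> (\<exists>u :: complex \<Rightarrow> real.
            harmonic_on unit_disk u \<and> u ` unit_disk \<subseteq> {\<alpha><..<\<beta>} \<and>
            (\<exists>z\<in>unit_disk.
               norm (gradient u z) = 2 * (\<beta> - \<alpha>) / pi *
                 ((1 - 4 / (\<beta> - \<alpha>)\<^sup>2 * \<bar>u z - (\<alpha> + \<beta>) / 2\<bar>\<^sup>2) / (1 - (norm z)\<^sup>2))))"
proof (intro conjI allI impI ballI)
  fix u :: "complex \<Rightarrow> real" and z :: complex
  assume "harmonic_on unit_disk u" "u ` unit_disk \<subseteq> {\<alpha><..<\<beta>}" "z \<in> unit_disk"
  with assms show "norm (gradient u z) \<le> 2 * (\<beta> - \<alpha>) / pi *
      ((1 - 4 / (\<beta> - \<alpha>)\<^sup>2 * \<bar>u z - (\<alpha> + \<beta>) / 2\<bar>\<^sup>2) / (1 - (norm z)\<^sup>2))"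
    by (rule harmonic_strip_gradient_bound)
next
  obtain u :: "complex \<Rightarrow> real" where u: "harmonic_on unit_disk u" "u ` unit_disk \<subseteq> {\<alpha><..<\<beta>}"
    "u 0 = (\<alpha> + \<beta>) / 2" "norm (gradient u 0) = 2 * (\<beta> - \<alpha>) / pi"
    using strip_gradient_bound_attained[OF assms] .
  show "\<exists>u :: complex \<Rightarrow> real.
      harmonic_on unit_disk u \<and> u ` unit_disk \<subseteq> {\<alpha><..<\<beta>} \<and>
      (\<exists>z\<in>unit_disk.
         norm (gradient u z) = 2 * (\<beta> - \<alpha>) / pi *
           ((1 - 4 / (\<beta> - \<alpha>)\<^sup>2 * \<bar>u z - (\<alpha> + \<beta>) / 2\<bar>\<^sup>2) / (1 - (norm z)\<^sup>2)))"
    using u by (intro exI[of _ u] conjI bexI[of _ 0]) simp_all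
qed

end
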